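(* Let $A$ and $B$ be two finite groups with identities $e_A,e_B$ and with generating sets $S_A$ and $S_B$, respectively, neither containing the identity, such that $|S_A|=|B|\geqslant 2$. Let $\phi:B\to \mathrm{Aut}(A)$, $b\mapsto\phi_b$, be an action of $B$ on $A$ such that $S_A=x^B$ for some $x\in S_A$, where $x^B=\{\phi_b(x): b\in B\}$ is the orbit of $x$. Let $$S=\{(e_A,s): s\in S_B\}\cup\{(x,e_B)\}\subset A\rtimes_\phi B$$ and assume $S=S^{-1}$. If the Cayley graph $C_A(S_A)$ is $\kappa$-optimal and the Cayley graph $C_B(S_B)$ is $\lambda'$-optimal, then the Cayley graph $C_{A\rtimes_\phi B}(S)$ is $\lambda'$-optimal if and only if $|S_A|\geqslant 2|S_B|$.
   Context: Cayley graph: for a finite group $\Gamma$ and a subset $S\subset\Gamma$ not containing the identity, $C_\Gamma(S)$ has vertex-set $\Gamma$ and edge-set $\{xy: x^{-1}y\in S,\ x,y\in\Gamma\}$; it is an undirected graph when $S=S^{-1}$. (Under the hypotheses, $S=S^{-1}$ is equivalent to $S_B=S_B^{-1}$ and $x=x^{-1}$, in which case also $S_A=S_A^{-1}$, so all three Cayley graphs are undirected.) An action of $B$ on $A$ is a group homomorphism $\phi:B\to\mathrm{Aut}(A)$, $\phi(b)=\phi_b$. The semidirect product $A\rtimes_\phi B$ is the set $A\times B$ with operation $(a_1,b_1)*(a_2,b_2)=(a_1\phi_{b_1}(a_2),b_1b_2)$. A graph $G$ is $\kappa$-optimal if its vertex-connectivity equals its minimum degree, $\kappa(G)=\delta(G)$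 (with $\kappa(K_m)=m-1$). For a non-trivial connected graph $G$, a set $F\subset E(G)$ is a restricted edge-cut if $G-F$ is disconnected and contains no isolated vertices; $\lambda'(G)$ is the minimum cardinality of a restricted edge-cut of $G$ (well-defined for every connected graph of order at least $4$ other than a star); $G$ is $\lambda'$-connected if $\lambda'(G)$ exists. With $\xi(G)=\min\{d_G(x)+d_G(y)-2: xy\in E(G)\}$, a $\lambda'$-connected graph $G$ is $\lambda'$-optimal if $\lambda'(G)=\xi(G)$. *)

theory Defs
  imports "HOL-Algebra.Generated_Groups" "HOL-Algebra.Group_Action"
begin

section \<open>Simple undirected graphs\<close>

record 'v graph =
  verts :: "'v set"
  edges :: "'v set set"

definition adj :: "'v graph \<Rightarrow> ('v \<times> 'v) set" where
  "adj G = {(u, v). {u, v} \<in> edges G}"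

text \<open>The graph without vertices counts as connected here; this only affects
  \<open>vertex_cut\<close>, where deleting all vertices must not count as disconnecting.\<close>

definition connected_graph :: "'v graph \<Rightarrow> bool" where
  "connected_graph G \<longleftrightarrow> (\<forall>u\<in>verts G. \<forall>v\<in>verts G. (u, v) \<in> (adj G)\<^sup>*)"

definition complete_graph :: "'v graph \<Rightarrow> bool" where
  "complete_graph G \<longleftrightarrow>
     (\<forall>u\<in>verts G. \<forall>v\<in>verts G. u \<noteq> v \<longrightarrow> {u, v} \<in> edges G)"

definition degree :: "'v graph \<Rightarrow> 'v \<Rightarrow> nat" where
  "degree G v = card {e \<in> edges G. v \<in> e}"

definition min_degree :: "'v graph \<Rightarrow> nat" where
  "min_degree G = Min (degree G ` verts G)"

definition del_verts :: "'v graph \<Rightarrow> 'v set \<Rightarrow> 'v graph" where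
  "del_verts G W = \<lparr>verts = verts G - W, edges = {e \<in> edges G. e \<inter> W = {}}\<rparr>"

definition del_edges :: "'v graph \<Rightarrow> 'v set set \<Rightarrow> 'v graph" where
  "del_edges G F = \<lparr>verts = verts G, edges = edges G - F\<rparr>"

definition vertex_cut :: "'v graph \<Rightarrow> 'v set \<Rightarrow> bool" where
  "vertex_cut G W \<longleftrightarrow> W \<subseteq> verts G \<and> \<not> connected_graph (del_verts G W)"

text \<open>Complete graphs have no vertex cut; the convention is \<open>\<kappa>(K\<^sub>m) = m - 1\<close>.\<close>

definition vertex_connectivity :: "'v graph \<Rightarrow> nat" where
  "vertex_connectivity G =
     (if complete_graph G then card (verts G) - 1
      else (LEAST k. \<exists>W. vertex_cut G W \<and> card W = k))"

definition kappa_optimal :: "'v graph \<Rightarrow> bool" where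
  "kappa_optimal G \<longleftrightarrow> vertex_connectivity G = min_degree G"

definition restricted_edge_cut :: "'v graph \<Rightarrow> 'v set set \<Rightarrow> bool" where
  "restricted_edge_cut G F \<longleftrightarrow>
     F \<subseteq> edges G \<and> \<not> connected_graph (del_edges G F) \<and>
     (\<forall>v\<in>verts G. degree (del_edges G F) v \<noteq> 0)"

text \<open>Existence of \<open>\<lambda>'(G)\<close>; only non-trivial connected graphs are considered.\<close>

definition lambda'_connected :: "'v graph \<Rightarrow> bool" where
  "lambda'_connected G \<longleftrightarrow>
     card (verts G) \<ge> 2 \<and> connected_graph G \<and> (\<exists>F. restricted_edge_cut G F)"

text \<open>Meaningful only for \<open>\<lambda>'\<close>-connected graphs.\<close>

definition lambda' :: "'v graph \<Rightarrow> nat" where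
  "lambda' G = (LEAST k. \<exists>F. restricted_edge_cut G F \<and> card F = k)"

definition min_edge_degree :: "'v graph \<Rightarrow> nat" (\<open>\<xi>\<close>) where
  "\<xi> G = Min {degree G x + degree G y - 2 | x y. {x, y} \<in> edges G}"

definition lambda'_optimal :: "'v graph \<Rightarrow> bool" where
  "lambda'_optimal G \<longleftrightarrow> lambda'_connected G \<and> lambda' G = \<xi> G"


section \<open>Cayley graphs\<close>

text \<open>Edges are unordered pairs, so this is the Cayley graph of \<open>S\<close> when
  \<open>S = S\<^sup>-\<^sup>1\<close> and \<open>\<one> \<notin> S\<close>.\<close>

definition cayley_graph :: "('a, 'c) monoid_scheme \<Rightarrow> 'a set \<Rightarrow> 'a graph" where
  "cayley_graph G S =
     \<lparr>verts = carrier G,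
      edges = {{x, y} | x y. x \<in> carrier G \<and> y \<in> carrier G \<and> inv\<^bsub>G\<^esub> x \<otimes>\<^bsub>G\<^esub> y \<in> S}\<rparr>"

lemma adj_cayley_graph:
  assumes "group G" "S \<subseteq> carrier G" "set_inv\<^bsub>G\<^esub> S = S"
  shows "adj (cayley_graph G S) =
    {(x, y). x \<in> carrier G \<and> y \<in> carrier G \<and> inv\<^bsub>G\<^esub> x \<otimes>\<^bsub>G\<^esub> y \<in> S}"
proof -
  interpret group G by fact
  have *: "inv\<^bsub>G\<^esub> y \<otimes>\<^bsub>G\<^esub> x \<in> S"
    if "x \<in> carrier G" "y \<in> carrier G" "inv\<^bsub>G\<^esub> x \<otimes>\<^bsub>G\<^esub> y \<in> S" for x y
  proof -
    have "inv\<^bsub>G\<^esub> (inv\<^bsub>G\<^esub> x \<otimes>\<^bsub>G\<^esub> y) \<in> set_inv\<^bsub>G\<^esub> S"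
      using that(3) by (auto simp: SET_INV_def)
    then show ?thesis
      using that assms(3) by (simp add: inv_mult_group)
  qed
  then show ?thesis
    by (auto simp: adj_def cayley_graph_def doubleton_eq_iff)
qed

lemma card_cayley_edge:
  assumes "group G" "\<one>\<^bsub>G\<^esub> \<notin> S" "e \<in> edges (cayley_graph G S)"
  shows "card e = 2"
  using assms by (auto simp: cayley_graph_def card_2_iff) (metis group.l_inv)


section \<open>Semidirect products\<close>

definition semidirect ::
  "('a, 'c) monoid_scheme \<Rightarrow> ('b, 'd) monoid_scheme \<Rightarrow> ('b \<Rightarrow> 'a \<Rightarrow> 'a) \<Rightarrow> ('a \<times> 'b) monoid" where
  "semidirect A B \<phi> =
     \<lparr>carrier = carrier A \<times> carrier B,
      mult = (\<lambda>(a1, b1) (a2, b2). (a1 \<otimes>\<^bsub>A\<^esub> \<phi> b1 a2, b1 \<otimes>\<^bsub>B\<^esub> b2)),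
      one = (\<one>\<^bsub>A\<^esub>, \<one>\<^bsub>B\<^esub>)\<rparr>"

lemma group_semidirect:
  assumes "group A" "group B" "\<phi> \<in> hom B (AutoGroup A)"
  shows "group (semidirect A B \<phi>)"
proof -
  interpret A: group A by fact
  interpret B: group B by fact
  interpret H: group_hom B "AutoGroup A" \<phi>
    using assms A.AutoGroup by (simp add: group_hom_def group_hom_axioms_def)
  have aut: "\<phi> b \<in> auto A" if "b \<in> carrier B" for b
    using H.hom_closed[OF that] by (simp add: AutoGroup_def)
  have closed: "\<phi> b a \<in> carrier A" if "a \<in> carrier A" "b \<in> carrier B" for a b
    using aut[OF that(2)] that(1) by (auto simp: auto_def hom_def)
  have hom: "\<phi> b (a \<otimes>\<^bsub>A\<^esub> a') = \<phi> b a \<otimes>\<^bsub>A\<^esub> \<phi> b a'"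
    if "a \<in> carrier A" "a' \<in> carrier A" "b \<in> carrier B" for a a' b
    using aut[OF that(3)] that(1,2) by (auto simp: auto_def hom_def)
  have one: "\<phi> \<one>\<^bsub>B\<^esub> a = a" if "a \<in> carrier A" for a
    using H.hom_one that by (simp add: AutoGroup_def BijGroup_def)
  have comp: "\<phi> (b \<otimes>\<^bsub>B\<^esub> b') a = \<phi> b (\<phi> b' a)"
    if "a \<in> carrier A" "b \<in> carrier B" "b' \<in> carrier B" for a b b'
    using H.hom_mult[OF that(2,3)] that aut[OF that(2)] aut[OF that(3)]
    by (simp add: AutoGroup_def BijGroup_def auto_def compose_eq)
  show ?thesis
  proof (rule groupI)
    fix g assume "g \<in> carrier (semidirect A B \<phi>)"
    then obtain a b where g: "g = (a, b)" "a \<in> carrier A" "b \<in> carrier B"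
      by (auto simp: semidirect_def)
    let ?h = "(\<phi> (inv\<^bsub>B\<^esub> b) (inv\<^bsub>A\<^esub> a), inv\<^bsub>B\<^esub> b)"
    have "\<phi> (inv\<^bsub>B\<^esub> b) (inv\<^bsub>A\<^esub> a) \<otimes>\<^bsub>A\<^esub> \<phi> (inv\<^bsub>B\<^esub> b) a = \<phi> (inv\<^bsub>B\<^esub> b) \<one>\<^bsub>A\<^esub>"
      using hom[of "inv\<^bsub>A\<^esub> a" a "inv\<^bsub>B\<^esub> b"] g by (simp del: H.hom_inv)
    also have "\<dots> = \<one>\<^bsub>A\<^esub>"
    proof -
      have "\<phi> (inv\<^bsub>B\<^esub> b) \<in> hom A A" using aut[OF B.inv_closed[OF g(3)]] unfolding auto_def by blast
      then show ?thesis by (rule hom_one[OF _ assms(1) assms(1)])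
    qed
    finally show "\<exists>h\<in>carrier (semidirect A B \<phi>). h \<otimes>\<^bsub>semidirect A B \<phi>\<^esub> g = \<one>\<^bsub>semidirect A B \<phi>\<^esub>"
      using g closed by (intro bexI[of _ ?h]) (auto simp: semidirect_def simp del: H.hom_inv)
  qed (auto simp: semidirect_def closed hom one comp A.m_assoc B.m_assoc
      simp del: H.hom_mult H.hom_one)
qed

end

theory Submission
  imports Defs
begin

text \<open>The Cayley graph of the semidirect product is a replacement product. Every vertex \<open>a\<close> of
  \<open>C\<^sub>A(S\<^sub>A)\<close> is blown up into a copy \<open>{a} \<times> B\<close> of \<open>C\<^sub>B(S\<^sub>B)\<close>, and the generator \<open>(x, e\<^sub>B)\<close> joins
  \<open>(a, b)\<close> to \<open>(a \<phi>\<^sub>b(x), b)\<close>. As the orbit of \<open>x\<close> has as many elements as \<open>B\<close>, the map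
  \<open>b \<mapsto> \<phi>\<^sub>b(x)\<close> is a bijection onto \<open>S\<^sub>A\<close>, so every edge of \<open>C\<^sub>A(S\<^sub>A)\<close> is realised by exactly one
  edge between two copies; symmetry of \<open>S\<close> makes \<open>x\<close>, hence every element of \<open>S\<^sub>A\<close>, an involution.

  Put \<open>n = |S\<^sub>A| = |B|\<close> and \<open>k = |S\<^sub>B|\<close>. The product is \<open>(k + 1)\<close>-regular, so \<open>\<xi> = 2k\<close>. The edges
  leaving a single copy form a restricted edge-cut with \<open>n\<close> elements, so optimality forces
  \<open>n \<ge> 2k\<close>. Conversely, the edges adjacent to a fixed edge form a restricted edge-cut with \<open>2k\<close>
  elements, and it remains to bound restricted cuts from below. Let \<open>U\<close> be a nonempty proper set
  of vertices such that neither \<open>U\<close> nor its complement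
  induces an isolated vertex. Its boundary is the sum of the boundaries of its fibres
  \<open>U\<^sub>a = {b. (a, b) \<in> U}\<close> in \<open>C\<^sub>B(S\<^sub>B)\<close> and of the boundary edges between copies (lemma
  \<open>cut_size_repl\<close>), and a nonempty proper fibre contributes at least \<open>k\<close> edges, since
  \<open>\<lambda>'\<close>-optimality implies that the edge-connectivity is the degree (\<open>cut_size_ge_degree\<close>).

  If both a full and an empty fibre occur, let \<open>P\<close>, \<open>Q\<close> and \<open>M\<close> consist of the \<open>a\<close> with full, empty
  and other (mixed) fibre. Whitney's argument that vertex-connectivity bounds edge-connectivity gives
  \<open>n = \<kappa>(C\<^sub>A(S\<^sub>A)) \<le> e(P, Q) + |M|\<close> (\<open>vertex_connectivity_le_cross\<close>); each mixed fibre pays for its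
  vertex of \<open>M\<close>, so the boundary has at least \<open>n \<ge> 2k\<close> edges. Otherwise, passing to the
  complement if necessary, no fibre is full. Two mixed fibres already give \<open>2k\<close>. If there is only
  one, then \<open>U = {a} \<times> X\<close> has boundary size \<open>|\<partial>X| + |X|\<close>: either \<open>X\<close> is a side of a restricted cut
  of \<open>C\<^sub>B(S\<^sub>B)\<close>, giving \<open>(2k - 2) + 2\<close>, or a vertex outside \<open>X\<close> has all its \<open>k\<close> neighbours in \<open>X\<close>,
  giving \<open>k + k\<close> (\<open>copy_part_cut\<close>).\<close>

section \<open>Edge cuts as vertex bipartitions\<close>

definition nbrs :: "'v graph \<Rightarrow> 'v \<Rightarrow> 'v set" where
  "nbrs G v = {w. {v, w} \<in> edges G}"

text \<open>Ordered pairs rather than edges: arcs remember the side on which each end lies, so a boundary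
  splits into images of other boundaries under injective maps.\<close>

definition cross :: "'v graph \<Rightarrow> 'v set \<Rightarrow> 'v set \<Rightarrow> ('v \<times> 'v) set" where
  "cross G X Y = {(u, v). u \<in> X \<and> v \<in> Y \<and> {u, v} \<in> edges G}"

definition cut_size :: "'v graph \<Rightarrow> 'v set \<Rightarrow> nat" where
  "cut_size G U = card (cross G U (verts G - U))"

text \<open>A vertex set whose boundary is a restricted edge-cut. Neither side is required to be connected.\<close>

definition restricted_side :: "'v graph \<Rightarrow> 'v set \<Rightarrow> bool" where
  "restricted_side G U \<longleftrightarrow>
     U \<subseteq> verts G \<and> U \<noteq> {} \<and> U \<noteq> verts G \<and>
     (\<forall>u\<in>U. \<exists>w\<in>U. {u, w} \<in> edges G) \<and>
     (\<forall>u\<in>verts G - U. \<exists>w\<in>verts G - U. {u, w} \<in> edges G)"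

lemma not_connected_iff:
  assumes "\<And>e. e \<in> edges H \<Longrightarrow> e \<subseteq> verts H"
  shows "\<not> connected_graph H \<longleftrightarrow>
    (\<exists>U\<subseteq>verts H. U \<noteq> {} \<and> U \<noteq> verts H \<and> cross H U (verts H - U) = {})"
proof
  assume "\<not> connected_graph H"
  then obtain u v where uv: "u \<in> verts H" "v \<in> verts H" "(u, v) \<notin> (adj H)\<^sup>*"
    by (auto simp: connected_graph_def)
  let ?U = "{w \<in> verts H. (u, w) \<in> (adj H)\<^sup>*}"
  have "cross H ?U (verts H - ?U) = {}"
    by (auto simp: cross_def adj_def intro: rtrancl_into_rtrancl)
  then show "\<exists>U\<subseteq>verts H. U \<noteq> {} \<and> U \<noteq> verts H \<and> cross H U (verts H - U) = {}"
    using uv by (intro exI[of _ ?U]) auto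
next
  assume "\<exists>U\<subseteq>verts H. U \<noteq> {} \<and> U \<noteq> verts H \<and> cross H U (verts H - U) = {}"
  then obtain U u v where U: "U \<subseteq> verts H" "cross H U (verts H - U) = {}"
    and uv: "u \<in> U" "v \<in> verts H" "v \<notin> U" by blast
  have "w \<in> U" if "(u, w) \<in> (adj H)\<^sup>*" for w
    using that
  proof induction
    case (step y z)
    then have "{y, z} \<in> edges H" by (simp add: adj_def)
    then show ?case using assms[of "{y, z}"] step U by (auto simp: cross_def)
  qed (use uv in simp)
  then show "\<not> connected_graph H"
    using uv U by (auto simp: connected_graph_def)
qed

lemma not_connectedI:
  assumes "\<And>e. e \<in> edges H \<Longrightarrow> e \<subseteq> verts H"
    and "U \<subseteq> verts H" "U \<noteq> {}" "U \<noteq> verts H" "cross H U (verts H - U) = {}"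
  shows "\<not> connected_graph H"
  using assms not_connected_iff by blast

locale finite_simple_graph =
  fixes G :: "'v graph"
  assumes finite_verts: "finite (verts G)"
    and edge_subset: "e \<in> edges G \<Longrightarrow> e \<subseteq> verts G"
    and edge_card: "e \<in> edges G \<Longrightarrow> card e = 2"
begin

lemma edgeD: "{u, v} \<in> edges G \<Longrightarrow> u \<in> verts G \<and> v \<in> verts G \<and> u \<noteq> v"
  using edge_subset[of "{u, v}"] edge_card[of "{u, v}"] by auto

lemma edge_cases:
  assumes "e \<in> edges G"
  obtains u v where "e = {u, v}" "u \<noteq> v" "u \<in> verts G" "v \<in> verts G"
  using edge_subset[OF assms] edge_card[OF assms] by (auto simp: card_2_iff)

lemma finite_edges: "finite (edges G)"
  using finite_subset[of "edges G" "Pow (verts G)"] edge_subset finite_verts by auto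

lemma finite_nbrs: "finite (nbrs G v)"
  by (rule finite_subset[OF _ finite_verts]) (auto simp: nbrs_def dest: edgeD)

lemma finite_cross: "finite (cross G X Y)"
  by (rule finite_subset[of _ "verts G \<times> verts G"])
    (auto simp: cross_def finite_verts dest: edgeD)

lemma degree_eq: "degree G v = card (nbrs G v)"
proof -
  have "bij_betw (\<lambda>w. {v, w}) (nbrs G v) {e \<in> edges G. v \<in> e}"
    unfolding bij_betw_def
  proof
    show "inj_on (\<lambda>w. {v, w}) (nbrs G v)"
      by (auto simp: inj_on_def doubleton_eq_iff)
    show "(\<lambda>w. {v, w}) ` nbrs G v = {e \<in> edges G. v \<in> e}"
    proof (intro subset_antisym subsetI)
      fix e assume "e \<in> {e \<in> edges G. v \<in> e}"
      then have e: "e \<in> edges G" "v \<in> e" by auto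
      then obtain w where "e = {v, w}" by (elim edge_cases) auto
      then show "e \<in> (\<lambda>w. {v, w}) ` nbrs G v" using e by (auto simp: nbrs_def)
    qed (auto simp: nbrs_def)
  qed
  then show ?thesis by (simp add: degree_def bij_betw_same_card)
qed

lemma cross_edges_inj: "inj_on (\<lambda>(u, v). {u, v}) (cross G U (verts G - U))"
  by (auto simp: inj_on_def cross_def doubleton_eq_iff)

lemma cut_size_compl:
  assumes "U \<subseteq> verts G"
  shows "cut_size G (verts G - U) = cut_size G U"
proof -
  have "cross G (verts G - U) (verts G - (verts G - U)) = prod.swap ` cross G U (verts G - U)"
    using assms by (auto simp: cross_def image_iff insert_commute)
  then show ?thesis by (simp add: cut_size_def card_image)
qed

lemma restricted_side_compl: "restricted_side G U \<Longrightarrow> restricted_side G (verts G - U)"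
  unfolding restricted_side_def by (auto simp: double_diff)

text \<open>A union of some but not all components of the graph without the cut is a restricted side: the
  surviving edge at each vertex stays on that vertex's side. The cut contains its whole boundary.\<close>

lemma restricted_side_of_cut:
  assumes "restricted_edge_cut G F"
  shows "\<exists>U. restricted_side G U \<and> cut_size G U \<le> card F"
proof -
  let ?H = "del_edges G F"
  have F: "F \<subseteq> edges G" and conn: "\<not> connected_graph ?H"
    and iso: "\<And>v. v \<in> verts G \<Longrightarrow> degree ?H v \<noteq> 0"
    using assms by (auto simp: restricted_edge_cut_def)
  obtain U where U: "U \<subseteq> verts G" "U \<noteq> {}" "U \<noteq> verts G"
    and none: "cross ?H U (verts G - U) = {}"
    using conn edge_subset by (subst (asm) not_connected_iff) (auto simp: del_edges_def)
  have nb: "\<exists>w. {v, w} \<in> edges G - F" if "v \<in> verts G" for v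
  proof -
    have "{e \<in> edges ?H. v \<in> e} \<noteq> {}"
      using iso[OF that] unfolding degree_def by (metis card.empty)
    then obtain e where e: "e \<in> edges G" "e \<notin> F" "v \<in> e" by (auto simp: del_edges_def)
    from e(1) show ?thesis
      by (rule edge_cases) (use e in \<open>auto simp: insert_commute\<close>)
  qed
  have same: "v \<in> U \<longleftrightarrow> w \<in> U" if "{v, w} \<in> edges G - F" for v w
  proof -
    have "{w, v} \<in> edges G - F" using that by (simp add: insert_commute)
    then show ?thesis
      using that none edgeD[of v w] by (auto simp: cross_def del_edges_def)
  qed
  have "restricted_side G U"
    unfolding restricted_side_def
  proof (intro conjI ballI)
    fix u assume "u \<in> U"
    then obtain w where "{u, w} \<in> edges G - F" using nb U by blast
    then show "\<exists>w\<in>U. {u, w} \<in> edges G" using same \<open>u \<in> U\<close> by blast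
  next
    fix u assume u: "u \<in> verts G - U"
    then obtain w where "{u, w} \<in> edges G - F" using nb by blast
    then show "\<exists>w\<in>verts G - U. {u, w} \<in> edges G" using same u edgeD by blast
  qed (use U in auto)
  moreover have "(\<lambda>(u, v). {u, v}) ` cross G U (verts G - U) \<subseteq> F"
    using none by (auto simp: cross_def del_edges_def)
  then have "cut_size G U \<le> card F"
    using card_mono[OF finite_subset[OF F finite_edges]] card_image[OF cross_edges_inj]
    by (metis cut_size_def)
  ultimately show ?thesis by blast
qed

lemma cut_of_restricted_side:
  assumes "restricted_side G U"
  shows "\<exists>F. restricted_edge_cut G F \<and> card F = cut_size G U"
proof -
  let ?F = "(\<lambda>(u, v). {u, v}) ` cross G U (verts G - U)"
  let ?H = "del_edges G ?F"
  have crossing: "{u, v} \<notin> ?F" if "u \<in> U \<longleftrightarrow> v \<in> U" for u v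
    using that by (auto simp: cross_def doubleton_eq_iff)
  have "\<not> connected_graph ?H"
  proof (rule not_connectedI[where U = U])
    show "cross ?H U (verts ?H - U) = {}"
      by (auto simp: del_edges_def cross_def)
  qed (use assms edge_subset in \<open>auto simp: restricted_side_def del_edges_def\<close>)
  moreover have "degree ?H v \<noteq> 0" if v: "v \<in> verts G" for v
  proof -
    obtain w where w: "{v, w} \<in> edges G" "v \<in> U \<longleftrightarrow> w \<in> U"
      using assms v unfolding restricted_side_def by blast
    then have "{v, w} \<in> {e \<in> edges ?H. v \<in> e}"
      using crossing[of v w] by (simp add: del_edges_def)
    moreover have "finite {e \<in> edges ?H. v \<in> e}"
      using finite_edges by (simp add: del_edges_def)
    ultimately show ?thesis unfolding degree_def by auto
  qed
  moreover have "?F \<subseteq> edges G" by (auto simp: cross_def)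
  ultimately have "restricted_edge_cut G ?F" by (simp add: restricted_edge_cut_def)
  then show ?thesis
    using card_image[OF cross_edges_inj] by (metis cut_size_def)
qed

text \<open>Optimality can thus be tested on vertex sets alone, without reference to edge sets.\<close>

lemma lambda'_optimal_iff:
  "lambda'_optimal G \<longleftrightarrow>
     card (verts G) \<ge> 2 \<and> connected_graph G \<and>
     (\<exists>U. restricted_side G U \<and> cut_size G U \<le> \<xi> G) \<and>
     (\<forall>U. restricted_side G U \<longrightarrow> \<xi> G \<le> cut_size G U)"
  (is "_ \<longleftrightarrow> ?R")
proof -
  let ?P = "\<lambda>k. \<exists>F. restricted_edge_cut G F \<and> card F = k"
  have least: "(LEAST k. ?P k) = m \<longleftrightarrow> ?P m \<and> (\<forall>k. ?P k \<longrightarrow> m \<le> k)" if "?P k" for k m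
    using LeastI[of ?P, OF that] Least_le[of ?P] by (metis le_antisym)
  show ?thesis
  proof
    assume opt: "lambda'_optimal G"
    then obtain k where "?P k" by (auto simp: lambda'_optimal_def lambda'_connected_def)
    with opt have "?P (\<xi> G)" "\<forall>k. ?P k \<longrightarrow> \<xi> G \<le> k"
      using least[of k "\<xi> G"] by (auto simp: lambda'_optimal_def lambda'_def)
    then show ?R
      using opt cut_of_restricted_side restricted_side_of_cut
      by (metis lambda'_optimal_def lambda'_connected_def)
  next
    assume R: ?R
    then obtain U where U: "restricted_side G U" "cut_size G U = \<xi> G"
      using le_antisym by blast
    then have P: "?P (\<xi> G)" using cut_of_restricted_side by metis
    moreover have "\<forall>k. ?P k \<longrightarrow> \<xi> G \<le> k"
      using R restricted_side_of_cut le_trans by blast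
    ultimately have "lambda' G = \<xi> G" using least[OF P] by (simp add: lambda'_def)
    then show "lambda'_optimal G"
      using R P by (auto simp: lambda'_optimal_def lambda'_connected_def)
  qed
qed

lemma connected_iff:
  "connected_graph G \<longleftrightarrow>
    (\<forall>U\<subseteq>verts G. U \<noteq> {} \<longrightarrow> U \<noteq> verts G \<longrightarrow> cross G U (verts G - U) \<noteq> {})"
  using not_connected_iff[of G] edge_subset by blast

lemma vertex_connectivity_le_order: "vertex_connectivity G \<le> card (verts G) - 1"
proof (cases "complete_graph G")
  case False
  then obtain u v where uv: "u \<in> verts G" "v \<in> verts G" "u \<noteq> v" "{u, v} \<notin> edges G"
    by (auto simp: complete_graph_def)
  let ?W = "verts G - {u, v}"
  have "\<not> connected_graph (del_verts G ?W)"
  proof (rule not_connectedI[where U = "{u}"])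
    show "{u} \<noteq> verts (del_verts G ?W)" using uv by (auto simp: del_verts_def)
  qed (use uv edge_subset in \<open>auto simp: del_verts_def cross_def\<close>)
  then have "vertex_cut G ?W" by (auto simp: vertex_cut_def)
  then have "vertex_connectivity G \<le> card ?W"
    using False by (auto simp: vertex_connectivity_def intro: Least_le)
  also have "card ?W \<le> card (verts G) - 1"
    using uv finite_verts by (simp add: card_Diff_subset)
  finally show ?thesis .
qed (simp add: vertex_connectivity_def)

text \<open>A relative form of Whitney's inequality between vertex- and edge-connectivity. Deleting the
  vertices outside \<open>P\<close> and \<open>Q\<close> and one end of each edge between \<open>P\<close> and \<open>Q\<close> separates what is left
  of the two sets. The ends can be chosen so that a given nonadjacent pair \<open>p\<close>, \<open>q\<close> survives; if no
  such pair exists, all \<open>|P| |Q| \<ge> |P| + |Q| - 1\<close> edges are present, and the connectivity is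
  less than the number of vertices.\<close>

lemma vertex_connectivity_le_cross:
  assumes PQ: "P \<subseteq> verts G" "Q \<subseteq> verts G" "P \<inter> Q = {}" "P \<noteq> {}" "Q \<noteq> {}"
  shows "vertex_connectivity G \<le> card (cross G P Q) + card (verts G - P - Q)"
proof (cases "\<exists>p\<in>P. \<exists>q\<in>Q. {p, q} \<notin> edges G")
  case True
  then obtain p q where pq: "p \<in> P" "q \<in> Q" "{p, q} \<notin> edges G" by blast
  \<comment> \<open>Each edge loses its end in \<open>P\<close>, except that an edge at \<open>p\<close> loses its end in \<open>Q\<close>;
    as \<open>q\<close> is not adjacent to \<open>p\<close>, neither vertex is deleted.\<close>
  define W where
    "W = (\<lambda>(u, v). if u = p then v else u) ` cross G P Q \<union> (verts G - P - Q)"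
  have "p \<notin> W" "q \<notin> W"
    using pq PQ by (auto simp: W_def cross_def split: if_splits)
  moreover have "u \<in> W \<or> v \<in> W" if "(u, v) \<in> cross G P Q" for u v
    unfolding W_def using imageI[OF that, of "\<lambda>(u, v). if u = p then v else u"]
    by (auto split: if_splits)
  then have "cross (del_verts G W) (P - W) (verts G - W - (P - W)) = {}"
    by (auto simp: cross_def del_verts_def W_def)
  ultimately have "\<not> connected_graph (del_verts G W)"
    using pq PQ
    by (intro not_connectedI[where U = "P - W"])
      (auto simp: del_verts_def dest: subsetD[OF edge_subset])
  moreover have "W \<subseteq> verts G" using PQ by (auto simp: W_def cross_def)
  ultimately have "vertex_cut G W" by (simp add: vertex_cut_def)
  moreover have "\<not> complete_graph G"
    using pq PQ(1-3) unfolding complete_graph_def by (metis disjoint_iff subsetD)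
  ultimately have "vertex_connectivity G \<le> card W"
    by (auto simp: vertex_connectivity_def intro: Least_le)
  also have "card W \<le> card (cross G P Q) + card (verts G - P - Q)"
    unfolding W_def
    by (rule order.trans[OF card_Un_le]) (simp add: card_image_le finite_cross)
  finally show ?thesis .
next
  case False
  have fin: "finite P" "finite Q" using PQ finite_verts finite_subset by blast+
  have "P \<times> Q = cross G P Q" using False by (auto simp: cross_def)
  then have "card (cross G P Q) = card P * card Q" by (metis card_cartesian_product)
  moreover have "card P > 0" "card Q > 0" using fin PQ by (auto simp: card_gt_0_iff)
  then have "card P + card Q - 1 \<le> card P * card Q"
    by (cases "card P"; cases "card Q") auto
  moreover have "card (verts G) = card P + card Q + card (verts G - P - Q)"
  proof -
    have "card (verts G - (P \<union> Q)) = card (verts G) - card (P \<union> Q)"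
      using fin PQ by (intro card_Diff_subset) auto
    moreover have "card (P \<union> Q) \<le> card (verts G)"
      using PQ finite_verts by (intro card_mono) auto
    ultimately show ?thesis using fin PQ by (simp add: card_Un_disjoint Diff_eq Int_assoc)
  qed
  ultimately show ?thesis using vertex_connectivity_le_order by linarith
qed

end

section \<open>Restricted edge-connectivity of regular graphs\<close>

locale regular_graph = finite_simple_graph +
  fixes k :: nat
  assumes regular: "v \<in> verts G \<Longrightarrow> card (nbrs G v) = k"
    and verts_nonempty: "verts G \<noteq> {}"
begin

lemma min_degree_regular: "min_degree G = k"
proof -
  have "degree G ` verts G = {k}"
    using verts_nonempty by (simp add: degree_eq regular image_constant_conv cong: image_cong_simp)
  then show ?thesis by (simp add: min_degree_def)
qed

lemma ex_edge: "k > 0 \<Longrightarrow> \<exists>u v. {u, v} \<in> edges G"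
proof -
  assume "k > 0"
  obtain v where "v \<in> verts G" using verts_nonempty by blast
  then have "nbrs G v \<noteq> {}" using regular[of v] \<open>k > 0\<close> by auto
  then show ?thesis by (auto simp: nbrs_def)
qed

lemma min_edge_degree_regular:
  assumes "k > 0"
  shows "\<xi> G = 2 * k - 2"
proof -
  have "{degree G x + degree G y - 2 |x y. {x, y} \<in> edges G} = {2 * k - 2}"
    (is "?D = _")
  proof -
    have "card (nbrs G x) = k \<and> card (nbrs G y) = k" if "{x, y} \<in> edges G" for x y
      using edgeD[OF that] regular by simp
    then have "?D \<subseteq> {2 * k - 2}" by (auto simp: degree_eq)
    moreover have "?D \<noteq> {}" using ex_edge[OF assms] by simp
    ultimately show "?D = {2 * k - 2}" by (simp only: subset_singleton_iff simp_thms)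
  qed
  then show ?thesis by (simp add: min_edge_degree_def)
qed

lemma isolated_imp_cut_size_ge:
  assumes U: "U \<subseteq> verts G" and v: "v \<in> verts G"
    and iso: "\<And>w. {v, w} \<in> edges G \<Longrightarrow> w \<in> U \<longleftrightarrow> v \<notin> U"
  shows "k \<le> cut_size G U"
proof (cases "v \<in> U")
  case True
  then have "Pair v ` nbrs G v \<subseteq> cross G U (verts G - U)"
    using iso by (auto simp: cross_def nbrs_def dest: edgeD)
  then have "card (Pair v ` nbrs G v) \<le> cut_size G U"
    unfolding cut_size_def by (rule card_mono[OF finite_cross])
  then show ?thesis using regular[OF v] by (simp add: card_image inj_on_def)
next
  case False
  then have "(\<lambda>w. (w, v)) ` nbrs G v \<subseteq> cross G U (verts G - U)"
    using iso v by (auto simp: cross_def nbrs_def insert_commute)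
  then have "card ((\<lambda>w. (w, v)) ` nbrs G v) \<le> cut_size G U"
    unfolding cut_size_def by (rule card_mono[OF finite_cross])
  then show ?thesis using regular[OF v] by (simp add: card_image inj_on_def)
qed

text \<open>By connectedness some edge leaves a restricted side, and its end on that side has a
  further neighbour there.\<close>

lemma degree_ge_2:
  assumes "lambda'_optimal G"
  shows "k \<ge> 2"
proof -
  obtain U where U: "restricted_side G U" and "connected_graph G"
    using assms lambda'_optimal_iff by blast
  then have "cross G U (verts G - U) \<noteq> {}"
    by (auto simp: connected_iff restricted_side_def)
  then obtain u v where uv: "u \<in> U" "v \<in> verts G - U" "{u, v} \<in> edges G"
    by (auto simp: cross_def)
  obtain w where w: "w \<in> U" "{u, w} \<in> edges G"
    using U uv(1) unfolding restricted_side_def by blast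
  have "card {v, w} \<le> card (nbrs G u)"
    using uv w by (intro card_mono finite_nbrs) (auto simp: nbrs_def)
  moreover have "v \<noteq> w" "u \<in> verts G" using uv w edgeD by auto
  ultimately show ?thesis using regular by simp
qed

text \<open>A boundary is either restricted, hence has at least \<open>2k - 2 \<ge> k\<close> edges, or contains all \<open>k\<close>
  edges at some vertex.\<close>

lemma cut_size_ge_degree:
  assumes opt: "lambda'_optimal G"
    and U: "U \<subseteq> verts G" "U \<noteq> {}" "U \<noteq> verts G"
  shows "k \<le> cut_size G U"
proof (cases "restricted_side G U")
  case True
  then have "\<xi> G \<le> cut_size G U" using opt lambda'_optimal_iff by blast
  then show ?thesis using degree_ge_2[OF opt] min_edge_degree_regular by simp
next
  case False
  then obtain v where "v \<in> verts G" "\<And>w. {v, w} \<in> edges G \<Longrightarrow> w \<in> U \<longleftrightarrow> v \<notin> U"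
    unfolding restricted_side_def using U edgeD by (metis Diff_iff subsetD)
  then show ?thesis using isolated_imp_cut_size_ge U by blast
qed

text \<open>Degree at least three leaves every vertex a neighbour outside a given edge. This is the upper
  bound \<open>\<lambda>' \<le> \<xi>\<close> for regular graphs.\<close>

lemma edge_restricted_side:
  assumes k: "k \<ge> 3" and uv: "{u, v} \<in> edges G"
  shows "restricted_side G {u, v}" "cut_size G {u, v} = 2 * k - 2"
proof -
  have inV: "u \<in> verts G" "v \<in> verts G" "u \<noteq> v" using edgeD[OF uv] by auto
  have outside: "\<exists>w'\<in>verts G - {u, v}. {w, w'} \<in> edges G" if "w \<in> verts G" for w
  proof -
    have "\<not> nbrs G w \<subseteq> {u, v}"
      using card_mono[of "{u, v}" "nbrs G w"] regular[OF that] k inV by auto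
    then show ?thesis using edgeD by (auto simp: nbrs_def)
  qed
  show "restricted_side G {u, v}"
    unfolding restricted_side_def
    using outside inV uv by (auto simp: insert_commute)
  have "cross G {u, v} (verts G - {u, v}) =
      Pair u ` (nbrs G u - {v}) \<union> Pair v ` (nbrs G v - {u})" (is "_ = ?X \<union> ?Y")
    by (auto simp: cross_def nbrs_def dest: edgeD)
  moreover have "card (?X \<union> ?Y) = card ?X + card ?Y"
    using inV finite_nbrs by (intro card_Un_disjoint) auto
  moreover have "v \<in> nbrs G u" "u \<in> nbrs G v"
    using uv by (auto simp: nbrs_def insert_commute)
  then have "card ?X = k - 1" "card ?Y = k - 1"
    using inV regular by (simp_all add: card_image inj_on_def card_Diff_singleton)
  ultimately show "cut_size G {u, v} = 2 * k - 2" by (simp add: cut_size_def)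
qed

lemma lambda'_optimal_regular_iff:
  assumes "k \<ge> 3" "connected_graph G"
  shows "lambda'_optimal G \<longleftrightarrow> (\<forall>U. restricted_side G U \<longrightarrow> 2 * k - 2 \<le> cut_size G U)"
proof -
  obtain u v where uv: "{u, v} \<in> edges G" using ex_edge assms by auto
  then have "card {u, v} \<le> card (verts G)"
    using edge_subset finite_verts by (intro card_mono) auto
  then have "card (verts G) \<ge> 2" using edge_card[OF uv] by simp
  moreover have "\<xi> G = 2 * k - 2" using min_edge_degree_regular assms by simp
  moreover have "\<exists>U. restricted_side G U \<and> cut_size G U \<le> 2 * k - 2"
    using edge_restricted_side[OF assms(1) uv] by (intro exI[of _ "{u, v}"]) simp
  ultimately show ?thesis using assms(2) by (simp add: lambda'_optimal_iff)
qed

end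

section \<open>Edge cuts of replacement products\<close>

text \<open>The labels \<open>\<tau> b a\<close> list the neighbours of \<open>a\<close> without repetition, one for each vertex \<open>b\<close> of \<open>GB\<close>.
  By the involution law both ends of an edge give it the same label, so an edge between two copies
  of \<open>GB\<close> joins vertices with the same second coordinate.\<close>

locale replacement_product =
  GA: finite_simple_graph GA + GB: regular_graph GB k
  for GA :: "'a graph" and GB :: "'b graph" and k :: nat +
  fixes \<tau> :: "'b \<Rightarrow> 'a \<Rightarrow> 'a"
  assumes label_involution: "a \<in> verts GA \<Longrightarrow> b \<in> verts GB \<Longrightarrow> \<tau> b (\<tau> b a) = a"
    and label_inj: "a \<in> verts GA \<Longrightarrow> inj_on (\<lambda>b. \<tau> b a) (verts GB)"
    and edges_GA: "edges GA = {{a, \<tau> b a} | a b. a \<in> verts GA \<and> b \<in> verts GB}"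
    and GA_nonempty: "verts GA \<noteq> {}"
begin

definition repl :: "('a \<times> 'b) graph" where
  "repl = \<lparr>verts = verts GA \<times> verts GB,
     edges = {{(a, b), (a, b')} | a b b'. a \<in> verts GA \<and> {b, b'} \<in> edges GB} \<union>
       {{(a, b), (\<tau> b a, b)} | a b. a \<in> verts GA \<and> b \<in> verts GB}\<rparr>"

lemma verts_repl: "verts repl = verts GA \<times> verts GB"
  by (simp add: repl_def)

lemma label_edge:
  assumes "a \<in> verts GA" "b \<in> verts GB"
  shows "\<tau> b a \<in> verts GA" "\<tau> b a \<noteq> a"
proof -
  have "{a, \<tau> b a} \<in> edges GA" using assms by (auto simp: edges_GA)
  from GA.edgeD[OF this] show "\<tau> b a \<in> verts GA" "\<tau> b a \<noteq> a" by metis+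
qed

lemma repl_edge_iff:
  "{(a, b), (a', b')} \<in> edges repl \<longleftrightarrow>
     a \<in> verts GA \<and> b \<in> verts GB \<and> (a' = a \<and> {b, b'} \<in> edges GB \<or> b' = b \<and> a' = \<tau> b a)"
proof
  assume "{(a, b), (a', b')} \<in> edges repl"
  then consider (inner) c d d' where "c \<in> verts GA" "{d, d'} \<in> edges GB"
      "{(a, b), (a', b')} = {(c, d), (c, d')}"
    | (outer) c d where "c \<in> verts GA" "d \<in> verts GB"
      "{(a, b), (a', b')} = {(c, d), (\<tau> d c, d)}"
    by (auto simp: repl_def)
  then show "a \<in> verts GA \<and> b \<in> verts GB \<and>
      (a' = a \<and> {b, b'} \<in> edges GB \<or> b' = b \<and> a' = \<tau> b a)"
  proof cases
    case inner
    then show ?thesis using GB.edgeD[of d d'] by (auto simp: doubleton_eq_iff insert_commute)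
  next
    case outer
    then show ?thesis
      using label_involution[of c d] label_edge[of c d] by (auto simp: doubleton_eq_iff)
  qed
qed (auto simp: repl_def)

sublocale repl: regular_graph repl "Suc k"
proof
  show "finite (verts repl)" by (simp add: verts_repl GA.finite_verts GB.finite_verts)
  show "verts repl \<noteq> {}" by (simp add: verts_repl GA_nonempty GB.verts_nonempty)
  show "e \<subseteq> verts repl" if "e \<in> edges repl" for e
    using that GB.edgeD label_edge(1) by (fastforce simp: repl_def)
  show "card e = 2" if "e \<in> edges repl" for e
    using that GB.edgeD label_edge(2) by (fastforce simp: repl_def)
  show "card (nbrs repl v) = Suc k" if v: "v \<in> verts repl" for v
  proof -
    obtain a b where ab: "v = (a, b)" "a \<in> verts GA" "b \<in> verts GB"
      using v by (auto simp: verts_repl)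
    have "nbrs repl v = insert (\<tau> b a, b) (Pair a ` nbrs GB b)"
      using ab by (auto simp: nbrs_def repl_edge_iff)
    moreover have "(\<tau> b a, b) \<notin> Pair a ` nbrs GB b" using label_edge ab by auto
    moreover have "card (Pair a ` nbrs GB b) = k"
      using GB.regular ab by (simp add: card_image inj_on_def)
    ultimately show ?thesis by (simp add: GB.finite_nbrs)
  qed
qed

definition fibre :: "('a \<times> 'b) set \<Rightarrow> 'a \<Rightarrow> 'b set" where
  "fibre U a = {b. (a, b) \<in> U}"

definition outer_cut :: "('a \<times> 'b) set \<Rightarrow> ('a \<times> 'b) set" where
  "outer_cut U = {(a, b) \<in> U. (\<tau> b a, b) \<notin> U}"

lemma fibre_subset: "U \<subseteq> verts repl \<Longrightarrow> fibre U a \<subseteq> verts GB"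
  by (auto simp: fibre_def verts_repl)

text \<open>An edge lies inside one copy of \<open>GB\<close> or joins two copies, never both, because \<open>\<tau> b a \<noteq> a\<close>. Each
  boundary edge of the second kind is determined by its end in \<open>U\<close>.\<close>

lemma cut_size_repl:
  assumes U: "U \<subseteq> verts repl"
  shows "cut_size repl U =
    (\<Sum>a\<in>verts GA. cut_size GB (fibre U a)) + card (outer_cut U)"
proof -
  define inner where
    "inner a = (\<lambda>(b, b'). ((a, b), (a, b'))) ` cross GB (fibre U a) (verts GB - fibre U a)"
    for a
  define outer where "outer = (\<lambda>(a, b). ((a, b), (\<tau> b a, b))) ` outer_cut U"
  have fin: "finite (inner a)" for a by (simp add: inner_def GB.finite_cross)
  have "finite (outer_cut U)"
    by (rule finite_subset[OF _ repl.finite_verts]) (use U in \<open>auto simp: outer_cut_def\<close>)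
  then have fin_outer: "finite outer" by (simp add: outer_def)
  have "cross repl U (verts repl - U) = (\<Union>a\<in>verts GA. inner a) \<union> outer"
  proof (intro subset_antisym subsetI)
    fix z assume z: "z \<in> cross repl U (verts repl - U)"
    then obtain a b a' b' where ab: "z = ((a, b), (a', b'))" "(a, b) \<in> U" "(a', b') \<notin> U"
      "{(a, b), (a', b')} \<in> edges repl"
      by (auto simp: cross_def)
    then consider "a' = a" "a \<in> verts GA" "{b, b'} \<in> edges GB" | "b' = b" "a' = \<tau> b a"
      by (auto simp: repl_edge_iff)
    then show "z \<in> (\<Union>a\<in>verts GA. inner a) \<union> outer"
    proof cases
      case 1
      then have "(b, b') \<in> cross GB (fibre U a) (verts GB - fibre U a)"
        using ab GB.edgeD by (auto simp: cross_def fibre_def)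
      then have "z \<in> inner a" using ab(1) 1 by (force simp: inner_def)
      then show ?thesis using 1 by blast
    next
      case 2
      then have "(a, b) \<in> outer_cut U" using ab by (simp add: outer_cut_def)
      then show ?thesis using ab(1) 2 by (force simp: outer_def)
    qed
  next
    fix z assume "z \<in> (\<Union>a\<in>verts GA. inner a) \<union> outer"
    then show "z \<in> cross repl U (verts repl - U)"
    proof
      assume "z \<in> (\<Union>a\<in>verts GA. inner a)"
      then show ?thesis
        by (auto simp: inner_def cross_def fibre_def verts_repl repl_edge_iff dest: GB.edgeD)
    next
      assume "z \<in> outer"
      then obtain a b where "z = ((a, b), (\<tau> b a, b))" "(a, b) \<in> U" "(\<tau> b a, b) \<notin> U"
        by (auto simp: outer_def outer_cut_def)
      then show ?thesis
        using U label_edge(1) by (auto simp: cross_def verts_repl repl_edge_iff)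
    qed
  qed
  moreover have "card ((\<Union>a\<in>verts GA. inner a) \<union> outer) =
      card (\<Union>a\<in>verts GA. inner a) + card outer"
  proof (rule card_Un_disjoint)
    show "(\<Union>a\<in>verts GA. inner a) \<inter> outer = {}"
      using U label_edge(2) by (auto simp: inner_def outer_def outer_cut_def verts_repl)
  qed (use fin fin_outer GA.finite_verts in auto)
  moreover have "card (\<Union>a\<in>verts GA. inner a) = (\<Sum>a\<in>verts GA. card (inner a))"
    using fin GA.finite_verts by (intro card_UN_disjoint) (auto simp: inner_def)
  moreover have "card (inner a) = cut_size GB (fibre U a)" for a
    unfolding inner_def cut_size_def by (rule card_image) (auto simp: inj_on_def)
  moreover have "card outer = card (outer_cut U)"
    unfolding outer_def by (rule card_image) (auto simp: inj_on_def)
  ultimately show ?thesis unfolding cut_size_def[of repl] by simp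
qed

lemma outer_cut_ge_cross:
  assumes U: "U \<subseteq> verts repl"
    and full: "\<And>a. a \<in> P \<Longrightarrow> fibre U a = verts GB"
    and empty: "\<And>a. a \<in> Q \<Longrightarrow> fibre U a = {}"
  shows "card (cross GA P Q) \<le> card (outer_cut U)"
proof -
  have "cross GA P Q \<subseteq> (\<lambda>(a, b). (a, \<tau> b a)) ` outer_cut U"
  proof clarify
    fix a a' assume "(a, a') \<in> cross GA P Q"
    then have aa': "a \<in> P" "a' \<in> Q" "{a, a'} \<in> edges GA" by (auto simp: cross_def)
    then obtain b where b: "b \<in> verts GB" "a' = \<tau> b a"
      using label_involution by (auto simp: edges_GA doubleton_eq_iff)
    have "(a, b) \<in> U" "(a', b) \<notin> U"
      using full[OF aa'(1)] empty[OF aa'(2)] b by (auto simp: fibre_def)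
    then have "(a, b) \<in> outer_cut U" using b by (simp add: outer_cut_def)
    then show "(a, a') \<in> (\<lambda>(a, b). (a, \<tau> b a)) ` outer_cut U" using b by force
  qed
  moreover have "finite (outer_cut U)"
    by (rule finite_subset[OF _ repl.finite_verts]) (use U in \<open>auto simp: outer_cut_def\<close>)
  ultimately show ?thesis by (meson card_image_le card_mono finite_imageI le_trans)
qed

lemma cut_size_copy:
  assumes "a \<in> verts GA" "X \<subseteq> verts GB"
  shows "cut_size repl ({a} \<times> X) = cut_size GB X + card X"
proof -
  have "fibre ({a} \<times> X) a' = (if a' = a then X else {})" for a'
    by (auto simp: fibre_def)
  moreover have "cut_size GB {} = 0" by (simp add: cut_size_def cross_def)
  ultimately have "(\<Sum>a'\<in>verts GA. cut_size GB (fibre ({a} \<times> X) a')) =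
      (\<Sum>a'\<in>verts GA. if a' = a then cut_size GB X else 0)"
    by (intro sum.cong) auto
  also have "\<dots> = cut_size GB X" using assms(1) GA.finite_verts by simp
  finally have "(\<Sum>a'\<in>verts GA. cut_size GB (fibre ({a} \<times> X) a')) = cut_size GB X" .
  moreover have "outer_cut ({a} \<times> X) = {a} \<times> X"
    using assms label_edge(2) by (auto simp: outer_cut_def)
  moreover have "{a} \<times> X \<subseteq> verts repl" using assms by (auto simp: verts_repl)
  ultimately show ?thesis by (simp add: cut_size_repl card_cartesian_product)
qed

end

text \<open>By injectivity of the labels \<open>GA\<close> is regular of degree \<open>card (verts GB)\<close>, so the first assumption
  expresses \<open>\<kappa>\<close>-optimality of \<open>GA\<close>.\<close>

locale optimal_replacement_product = replacement_product +
  assumes vertex_connectivity_GA: "vertex_connectivity GA = card (verts GB)"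
    and optimal_GB: "lambda'_optimal GB"
begin

definition mixed :: "('a \<times> 'b) set \<Rightarrow> 'a set" where
  "mixed U = {a \<in> verts GA. fibre U a \<noteq> {} \<and> fibre U a \<noteq> verts GB}"

lemma mixed_cut:
  assumes U: "U \<subseteq> verts repl"
  shows "card (mixed U) * k + card (outer_cut U) \<le> cut_size repl U"
proof -
  have "card (mixed U) * k \<le> (\<Sum>a\<in>mixed U. cut_size GB (fibre U a))"
    using sum_bounded_below[of "mixed U" k "\<lambda>a. cut_size GB (fibre U a)"]
      GB.cut_size_ge_degree[OF optimal_GB fibre_subset[OF U]]
    by (simp add: mixed_def)
  also have "\<dots> \<le> (\<Sum>a\<in>verts GA. cut_size GB (fibre U a))"
    by (rule sum_mono2) (auto simp: mixed_def GA.finite_verts)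
  finally show ?thesis by (simp add: cut_size_repl[OF U])
qed

text \<open>Boundary edges between full and empty copies lift the edges of \<open>GA\<close> between the corresponding
  vertices. Whitney's inequality bounds these from below up to the number of mixed copies, and each
  mixed copy makes up for its vertex with at least one internal boundary edge.\<close>

lemma full_and_empty_cut:
  assumes U: "U \<subseteq> verts repl"
    and p: "p \<in> verts GA" "fibre U p = verts GB"
    and q: "q \<in> verts GA" "fibre U q = {}"
  shows "card (verts GB) \<le> cut_size repl U"
proof -
  let ?P = "{a \<in> verts GA. fibre U a = verts GB}"
  let ?Q = "{a \<in> verts GA. fibre U a = {}}"
  have "vertex_connectivity GA \<le> card (cross GA ?P ?Q) + card (verts GA - ?P - ?Q)"
    using p q GB.verts_nonempty by (intro GA.vertex_connectivity_le_cross) auto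
  also have "verts GA - ?P - ?Q = mixed U" by (auto simp: mixed_def)
  finally have "card (verts GB) \<le> card (cross GA ?P ?Q) + card (mixed U)"
    by (simp only: vertex_connectivity_GA)
  moreover have "card (cross GA ?P ?Q) \<le> card (outer_cut U)"
    using U by (intro outer_cut_ge_cross) auto
  moreover have "card (mixed U) \<le> card (mixed U) * k"
    using GB.degree_ge_2[OF optimal_GB] by simp
  ultimately show ?thesis using mixed_cut[OF U] by linarith
qed

text \<open>A nonempty proper set of vertices with empty boundary has no mixed copy, so it has a full and
  an empty one, and the previous lemma applies.\<close>

lemma connected_repl: "connected_graph repl"
  unfolding repl.connected_iff
proof (intro allI impI notI)
  fix U assume U: "U \<subseteq> verts repl" "U \<noteq> {}" "U \<noteq> verts repl"
    and "cross repl U (verts repl - U) = {}"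
  then have zero: "cut_size repl U = 0" by (simp add: cut_size_def)
  have "mixed U = {}"
  proof -
    have "finite (mixed U)" by (simp add: mixed_def GA.finite_verts)
    then show ?thesis
      using mixed_cut[OF U(1)] zero GB.degree_ge_2[OF optimal_GB] by simp
  qed
  obtain p b where "(p, b) \<in> U" using U by auto
  then have p: "p \<in> verts GA" "fibre U p = verts GB"
    using U(1) \<open>mixed U = {}\<close> by (auto simp: mixed_def fibre_def verts_repl)
  obtain q b' where "(q, b') \<notin> U" "q \<in> verts GA" "b' \<in> verts GB"
    using U by (auto simp: verts_repl)
  then have "fibre U q = {}"
    using \<open>mixed U = {}\<close> by (auto simp: mixed_def fibre_def)
  then have "card (verts GB) \<le> 0"
    using full_and_empty_cut[OF U(1) p \<open>q \<in> verts GA\<close>] zero by simp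
  then show False using GB.finite_verts GB.verts_nonempty by simp
qed

text \<open>The edge leaving the copy at \<open>(a, b)\<close> never ends in \<open>{a} \<times> X\<close>. Therefore every vertex of \<open>X\<close>
  has a neighbour within \<open>X\<close>, and \<open>|X|\<close> boundary edges leave the copy. If \<open>X\<close> fails to be a restricted
  side, this is due to a vertex outside \<open>X\<close>, whose neighbourhood forces \<open>|X| \<ge> k\<close>.\<close>

lemma copy_part_cut:
  assumes a: "a \<in> verts GA" and X: "X \<subseteq> verts GB" "X \<noteq> verts GB"
    and side: "restricted_side repl ({a} \<times> X)"
  shows "2 * k \<le> cut_size repl ({a} \<times> X)"
proof -
  have finX: "finite X" using X GB.finite_verts finite_subset by blast
  have nonempty: "X \<noteq> {}" using side by (auto simp: restricted_side_def)
  have inside: "\<exists>b'\<in>X. {b, b'} \<in> edges GB" if "b \<in> X" for b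
  proof -
    have "\<exists>w\<in>{a} \<times> X. {(a, b), w} \<in> edges repl"
      using side that unfolding restricted_side_def by blast
    then obtain b' where "b' \<in> X" "{(a, b), (a, b')} \<in> edges repl" by blast
    then show ?thesis using label_edge(2)[OF a, of b] by (auto simp: repl_edge_iff)
  qed
  have "2 * k \<le> cut_size GB X + card X"
  proof (cases "restricted_side GB X")
    case True
    then have "2 * k - 2 \<le> cut_size GB X"
      using optimal_GB GB.lambda'_optimal_iff GB.min_edge_degree_regular
        GB.degree_ge_2[OF optimal_GB] by simp
    moreover obtain b b' where bb': "b \<in> X" "b' \<in> X" "{b, b'} \<in> edges GB"
      using nonempty inside by blast
    then have "card {b, b'} \<le> card X" using finX by (intro card_mono) auto
    moreover have "b \<noteq> b'" using GB.edgeD[OF bb'(3)] by blast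
    ultimately show ?thesis by simp
  next
    case False
    then obtain y where y: "y \<in> verts GB - X" "\<And>w. w \<in> verts GB - X \<Longrightarrow> {y, w} \<notin> edges GB"
      unfolding restricted_side_def using X nonempty inside by auto
    then have "nbrs GB y \<subseteq> X" using GB.edgeD by (auto simp: nbrs_def)
    then have "card (nbrs GB y) \<le> card X" by (rule card_mono[OF finX])
    then have "k \<le> card X" using GB.regular y(1) by simp
    moreover have "k \<le> cut_size GB X"
      by (rule GB.cut_size_ge_degree[OF optimal_GB X(1) nonempty X(2)])
    ultimately show ?thesis by simp
  qed
  then show ?thesis by (simp add: cut_size_copy[OF a X(1)])
qed

lemma no_full_copy_cut:
  assumes side: "restricted_side repl U"
    and no_full: "\<And>a. a \<in> verts GA \<Longrightarrow> fibre U a \<noteq> verts GB"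
  shows "2 * k \<le> cut_size repl U"
proof -
  have U: "U \<subseteq> verts repl" "U \<noteq> {}" using side by (auto simp: restricted_side_def)
  have mixed: "a \<in> mixed U" if "(a, b) \<in> U" for a b
    using that U(1) no_full by (auto simp: mixed_def fibre_def verts_repl)
  have fin: "finite (mixed U)" by (simp add: mixed_def GA.finite_verts)
  obtain a b where ab: "(a, b) \<in> U" using U(2) by auto
  show ?thesis
  proof (cases "mixed U = {a}")
    case True
    have "U = {a} \<times> fibre U a" using mixed True by (auto simp: fibre_def)
    moreover have "a \<in> verts GA" using True by (auto simp: mixed_def)
    ultimately show ?thesis
      using copy_part_cut[of a "fibre U a"] side no_full fibre_subset[OF U(1)] by metis
  next
    case False
    then obtain a' where "a' \<in> mixed U" "a' \<noteq> a" using mixed[OF ab] by blast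
    then have "card {a, a'} \<le> card (mixed U)" using mixed[OF ab] fin by (intro card_mono) auto
    then have "2 * k \<le> card (mixed U) * k" using \<open>a' \<noteq> a\<close> by simp
    then show ?thesis using mixed_cut[OF U(1)] by linarith
  qed
qed

text \<open>If no copy is empty, then no copy is full for the complement, which has the same boundary.\<close>

lemma restricted_side_cut:
  assumes side: "restricted_side repl U" and large: "2 * k \<le> card (verts GB)"
  shows "2 * k \<le> cut_size repl U"
proof -
  have U: "U \<subseteq> verts repl" using side by (auto simp: restricted_side_def)
  consider (no_full) "\<forall>a\<in>verts GA. fibre U a \<noteq> verts GB"
    | (no_empty) "\<forall>a\<in>verts GA. fibre U a \<noteq> {}"
    | (both) p q where "p \<in> verts GA" "fibre U p = verts GB" "q \<in> verts GA" "fibre U q = {}"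
    by blast
  then show ?thesis
  proof cases
    case no_full
    then show ?thesis using no_full_copy_cut side by blast
  next
    case no_empty
    have "fibre (verts repl - U) a \<noteq> verts GB" if "a \<in> verts GA" for a
      using no_empty that fibre_subset[OF U, of a] by (auto simp: fibre_def verts_repl)
    then have "2 * k \<le> cut_size repl (verts repl - U)"
      using no_full_copy_cut repl.restricted_side_compl[OF side] by blast
    then show ?thesis using repl.cut_size_compl[OF U] by simp
  next
    case both
    then show ?thesis using full_and_empty_cut[OF U] large by fastforce
  qed
qed

lemma copy_restricted_side:
  assumes a: "a \<in> verts GA"
  shows "restricted_side repl ({a} \<times> verts GB)"
proof -
  have "\<exists>b'\<in>verts GB. {b, b'} \<in> edges GB" if "b \<in> verts GB" for b
  proof -
    have "card (nbrs GB b) \<noteq> 0"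
      using GB.regular[OF that] GB.degree_ge_2[OF optimal_GB] by simp
    then have "nbrs GB b \<noteq> {}" by auto
    then show ?thesis using GB.edgeD by (auto simp: nbrs_def)
  qed
  then have inner: "\<exists>b'\<in>verts GB. {(c, b), (c, b')} \<in> edges repl"
    if "c \<in> verts GA" "b \<in> verts GB" for b c
    using that unfolding repl_edge_iff by blast
  obtain b where b: "b \<in> verts GB" using GB.verts_nonempty by blast
  show ?thesis
    unfolding restricted_side_def
  proof (intro conjI ballI)
    show "{a} \<times> verts GB \<noteq> verts repl"
      using label_edge[OF a b] b by (auto simp: verts_repl)
    fix u assume u: "u \<in> verts repl - {a} \<times> verts GB"
    then obtain c b where "u = (c, b)" "c \<in> verts GA" "b \<in> verts GB" "c \<noteq> a"
      by (auto simp: verts_repl)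
    then show "\<exists>w\<in>verts repl - {a} \<times> verts GB. {u, w} \<in> edges repl"
      using inner[of c b] by (auto simp: verts_repl)
  qed (use a b inner in \<open>auto simp: verts_repl\<close>)
qed

theorem lambda'_optimal_repl_iff: "lambda'_optimal repl \<longleftrightarrow> 2 * k \<le> card (verts GB)"
proof -
  have "Suc k \<ge> 3" using GB.degree_ge_2[OF optimal_GB] by simp
  then have iff: "lambda'_optimal repl \<longleftrightarrow>
      (\<forall>U. restricted_side repl U \<longrightarrow> 2 * k \<le> cut_size repl U)"
    using repl.lambda'_optimal_regular_iff[OF _ connected_repl] by simp
  obtain a where a: "a \<in> verts GA" using GA_nonempty by blast
  have "cut_size GB (verts GB) = 0" by (simp add: cut_size_def cross_def)
  then have "cut_size repl ({a} \<times> verts GB) = card (verts GB)"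
    using cut_size_copy[OF a subset_refl] by simp
  then show ?thesis
    using iff copy_restricted_side[OF a] restricted_side_cut by metis
qed

end

section \<open>Cayley graphs of semidirect products\<close>

lemma cayley_edge_iff:
  assumes "group G" "S \<subseteq> carrier G" "set_inv\<^bsub>G\<^esub> S = S"
  shows "{u, v} \<in> edges (cayley_graph G S) \<longleftrightarrow> u \<in> carrier G \<and> (\<exists>s\<in>S. v = u \<otimes>\<^bsub>G\<^esub> s)"
proof -
  interpret group G by fact
  have "{u, v} \<in> edges (cayley_graph G S) \<longleftrightarrow>
      u \<in> carrier G \<and> v \<in> carrier G \<and> inv\<^bsub>G\<^esub> u \<otimes>\<^bsub>G\<^esub> v \<in> S"
    using adj_cayley_graph[OF assms] by (auto simp: adj_def set_eq_iff)
  also have "\<dots> \<longleftrightarrow> u \<in> carrier G \<and> (\<exists>s\<in>S. v = u \<otimes>\<^bsub>G\<^esub> s)"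
    using assms(2) inv_solve_left'[of _ u v] by (auto simp: m_assoc[symmetric])
  finally show ?thesis .
qed

lemma regular_cayley_graph:
  assumes "group G" "finite (carrier G)" "S \<subseteq> carrier G" "set_inv\<^bsub>G\<^esub> S = S" "\<one>\<^bsub>G\<^esub> \<notin> S"
  shows "regular_graph (cayley_graph G S) (card S)"
proof
  interpret group G by fact
  show "finite (verts (cayley_graph G S))" using assms by (simp add: cayley_graph_def)
  show "verts (cayley_graph G S) \<noteq> {}" using one_closed by (auto simp: cayley_graph_def)
  show "e \<subseteq> verts (cayley_graph G S)" if "e \<in> edges (cayley_graph G S)" for e
    using that by (auto simp: cayley_graph_def)
  show "card e = 2" if "e \<in> edges (cayley_graph G S)" for e
    using card_cayley_edge assms that by blast
  fix v assume "v \<in> verts (cayley_graph G S)"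
  then have v: "v \<in> carrier G" by (simp add: cayley_graph_def)
  then have "nbrs (cayley_graph G S) v = (\<lambda>s. v \<otimes>\<^bsub>G\<^esub> s) ` S"
    using cayley_edge_iff[OF assms(1,3,4)] by (auto simp: nbrs_def)
  moreover have "inj_on (\<lambda>s. v \<otimes>\<^bsub>G\<^esub> s) S"
    using v assms(3) by (auto simp: inj_on_def subset_iff)
  ultimately show "card (nbrs (cayley_graph G S) v) = card S" by (simp add: card_image)
qed

text \<open>Edges are sets of vertices, whereas both graphs compared below describe their edges by pairs of
  adjacent vertices.\<close>

lemma graph_eqI:
  fixes G H :: "'v graph"
  assumes "finite_simple_graph G" "finite_simple_graph H" "verts G = verts H"
    and "\<And>u v. {u, v} \<in> edges G \<longleftrightarrow> {u, v} \<in> edges H"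
  shows "G = H"
proof -
  have "e \<in> edges G \<longleftrightarrow> e \<in> edges H" for e
    using assms(4) finite_simple_graph.edge_cases[OF assms(1)]
      finite_simple_graph.edge_cases[OF assms(2)] by metis
  then have "edges G = edges H" by blast
  then show ?thesis using assms(3) by simp
qed

theorem theorem5p7:
  fixes A :: "('a, 'c) monoid_scheme" and B :: "('b, 'd) monoid_scheme"
    and S\<^sub>A :: "'a set" and S\<^sub>B :: "'b set" and S :: "('a \<times> 'b) set"
    and \<phi> :: "'b \<Rightarrow> 'a \<Rightarrow> 'a" and x :: 'a
  assumes "group A" and "finite (carrier A)"
    and "group B" and "finite (carrier B)"
    and "S\<^sub>A \<subseteq> carrier A" and "generate A S\<^sub>A = carrier A" and "\<one>\<^bsub>A\<^esub> \<notin> S\<^sub>A"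
    and "S\<^sub>B \<subseteq> carrier B" and "generate B S\<^sub>B = carrier B" and "\<one>\<^bsub>B\<^esub> \<notin> S\<^sub>B"
    and "card S\<^sub>A = order B" and "order B \<ge> 2"
    and "\<phi> \<in> hom B (AutoGroup A)"
    and "x \<in> S\<^sub>A" and "S\<^sub>A = orbit B \<phi> x"
    and "S = {(\<one>\<^bsub>A\<^esub>, s) | s. s \<in> S\<^sub>B} \<union> {(x, \<one>\<^bsub>B\<^esub>)}"
    and "S = set_inv\<^bsub>semidirect A B \<phi>\<^esub> S"
    and "kappa_optimal (cayley_graph A S\<^sub>A)"
    and "lambda'_optimal (cayley_graph B S\<^sub>B)"
  shows "lambda'_optimal (cayley_graph (semidirect A B \<phi>) S) \<longleftrightarrow> card S\<^sub>A \<ge> 2 * card S\<^sub>B"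
proof -
  interpret A: group A by fact
  interpret B: group B by fact
  interpret SD: group "semidirect A B \<phi>"
    by (rule group_semidirect) fact+
  have aut: "\<phi> b \<in> auto A" if "b \<in> carrier B" for b
    using hom_in_carrier[OF \<open>\<phi> \<in> hom B (AutoGroup A)\<close> that] by (simp add: AutoGroup_def)
  have act_hom: "\<phi> b \<in> hom A A" if "b \<in> carrier B" for b
    using aut[OF that] by (simp add: auto_def)
  have act_one: "\<phi> b \<one>\<^bsub>A\<^esub> = \<one>\<^bsub>A\<^esub>" if "b \<in> carrier B" for b
    by (rule hom_one[OF act_hom[OF that]]) fact+
  have act_id: "\<phi> \<one>\<^bsub>B\<^esub> a = a" if "a \<in> carrier A" for a
    using hom_one[OF \<open>\<phi> \<in> hom B (AutoGroup A)\<close> \<open>group B\<close> A.AutoGroup] that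
    by (simp add: AutoGroup_def BijGroup_def)
  have orbit: "S\<^sub>A = (\<lambda>b. \<phi> b x) ` carrier B"
    using \<open>S\<^sub>A = orbit B \<phi> x\<close> by (auto simp: orbit_def)
  then have act_inj: "inj_on (\<lambda>b. \<phi> b x) (carrier B)"
    using \<open>card S\<^sub>A = order B\<close> \<open>finite (carrier B)\<close>
    by (intro eq_card_imp_inj_on) (simp_all add: order_def)
  have x: "x \<in> carrier A" using \<open>x \<in> S\<^sub>A\<close> \<open>S\<^sub>A \<subseteq> carrier A\<close> by blast
  have SA: "\<phi> b x \<in> carrier A" "\<phi> b x \<in> S\<^sub>A" if "b \<in> carrier B" for b
    using orbit that \<open>S\<^sub>A \<subseteq> carrier A\<close> by auto
  have SD_carrier: "carrier (semidirect A B \<phi>) = carrier A \<times> carrier B"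
    and SD_mult: "(a, b) \<otimes>\<^bsub>semidirect A B \<phi>\<^esub> (a', b') = (a \<otimes>\<^bsub>A\<^esub> \<phi> b a', b \<otimes>\<^bsub>B\<^esub> b')"
    and SD_one: "\<one>\<^bsub>semidirect A B \<phi>\<^esub> = (\<one>\<^bsub>A\<^esub>, \<one>\<^bsub>B\<^esub>)" for a b a' b'
    by (simp_all add: semidirect_def)
  have inv_in_S: "inv\<^bsub>semidirect A B \<phi>\<^esub> s \<in> S" if "s \<in> S" for s
    using \<open>S = set_inv\<^bsub>semidirect A B \<phi>\<^esub> S\<close> that by (auto simp: SET_INV_def)

  \<comment> \<open>The inverse of \<open>(x, \<one>)\<close> lies in \<open>S\<close> but not among the generators from \<open>B\<close>, so \<open>x\<close> is an
    involution, and so are its images under automorphisms.\<close>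
  have "inv\<^bsub>semidirect A B \<phi>\<^esub> (x, \<one>\<^bsub>B\<^esub>) = (inv\<^bsub>A\<^esub> x, \<one>\<^bsub>B\<^esub>)"
    using x by (intro SD.inv_equality) (simp_all add: SD_carrier SD_mult SD_one act_id)
  then have "(inv\<^bsub>A\<^esub> x, \<one>\<^bsub>B\<^esub>) \<in> S" using inv_in_S[of "(x, \<one>\<^bsub>B\<^esub>)"] assms(16) by auto
  then have "inv\<^bsub>A\<^esub> x = x" using assms(16) \<open>\<one>\<^bsub>B\<^esub> \<notin> S\<^sub>B\<close> by auto
  then have xx: "x \<otimes>\<^bsub>A\<^esub> x = \<one>\<^bsub>A\<^esub>" using A.l_inv[OF x] by simp
  have invol: "\<phi> b x \<otimes>\<^bsub>A\<^esub> \<phi> b x = \<one>\<^bsub>A\<^esub>" if "b \<in> carrier B" for b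
    using hom_mult[OF act_hom[OF that] x x] xx act_one[OF that] by simp
  have inv_SA: "inv\<^bsub>A\<^esub> s = s" if "s \<in> S\<^sub>A" for s
    using that invol SA orbit by (auto intro!: A.inv_equality)
  have sym_A: "set_inv\<^bsub>A\<^esub> S\<^sub>A = S\<^sub>A"
    using inv_SA by (force simp: SET_INV_def)

  have "inv\<^bsub>semidirect A B \<phi>\<^esub> (\<one>\<^bsub>A\<^esub>, s) = (\<one>\<^bsub>A\<^esub>, inv\<^bsub>B\<^esub> s)" if "s \<in> carrier B" for s
    using that by (intro SD.inv_equality) (simp_all add: SD_carrier SD_mult SD_one act_one)
  then have inv_SB: "inv\<^bsub>B\<^esub> s \<in> S\<^sub>B" if "s \<in> S\<^sub>B" for s
    using inv_in_S[of "(\<one>\<^bsub>A\<^esub>, s)"] that assms(16) \<open>S\<^sub>B \<subseteq> carrier B\<close> \<open>\<one>\<^bsub>A\<^esub> \<notin> S\<^sub>A\<close> \<open>x \<in> S\<^sub>A\<close>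
    by auto
  have sym_B: "set_inv\<^bsub>B\<^esub> S\<^sub>B = S\<^sub>B"
  proof (intro subset_antisym subsetI)
    fix s assume "s \<in> S\<^sub>B"
    then have "inv\<^bsub>B\<^esub> (inv\<^bsub>B\<^esub> s) = s" "inv\<^bsub>B\<^esub> s \<in> S\<^sub>B"
      using inv_SB \<open>S\<^sub>B \<subseteq> carrier B\<close> by auto
    then show "s \<in> set_inv\<^bsub>B\<^esub> S\<^sub>B" by (force simp: SET_INV_def)
  qed (auto simp: SET_INV_def inv_SB)

  let ?GA = "cayley_graph A S\<^sub>A" and ?GB = "cayley_graph B S\<^sub>B"
  let ?G = "cayley_graph (semidirect A B \<phi>) S" and ?\<tau> = "\<lambda>b a. a \<otimes>\<^bsub>A\<^esub> \<phi> b x"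
  interpret GA: regular_graph ?GA "card S\<^sub>A"
    by (rule regular_cayley_graph[OF \<open>group A\<close> \<open>finite (carrier A)\<close> \<open>S\<^sub>A \<subseteq> carrier A\<close> sym_A
      \<open>\<one>\<^bsub>A\<^esub> \<notin> S\<^sub>A\<close>])
  interpret GB: regular_graph ?GB "card S\<^sub>B"
    by (rule regular_cayley_graph[OF \<open>group B\<close> \<open>finite (carrier B)\<close> \<open>S\<^sub>B \<subseteq> carrier B\<close> sym_B
      \<open>\<one>\<^bsub>B\<^esub> \<notin> S\<^sub>B\<close>])
  have S_carrier: "S \<subseteq> carrier (semidirect A B \<phi>)"
    using assms(16) x \<open>S\<^sub>B \<subseteq> carrier B\<close> by (auto simp: SD_carrier)
  interpret G: regular_graph ?G "card S"
  proof (rule regular_cayley_graph)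
    show "\<one>\<^bsub>semidirect A B \<phi>\<^esub> \<notin> S"
      using assms(16) \<open>\<one>\<^bsub>A\<^esub> \<notin> S\<^sub>A\<close> \<open>\<one>\<^bsub>B\<^esub> \<notin> S\<^sub>B\<close> \<open>x \<in> S\<^sub>A\<close> by (auto simp: SD_one)
  qed (use SD.group_axioms S_carrier assms(2,4,17) in \<open>auto simp: SD_carrier\<close>)
  note edge_A = cayley_edge_iff[OF \<open>group A\<close> \<open>S\<^sub>A \<subseteq> carrier A\<close> sym_A]
  note edge_B = cayley_edge_iff[OF \<open>group B\<close> \<open>S\<^sub>B \<subseteq> carrier B\<close> sym_B]
  have verts: "verts ?GA = carrier A" "verts ?GB = carrier B" "verts ?G = carrier A \<times> carrier B"
    by (simp_all add: cayley_graph_def SD_carrier)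
  interpret RP: optimal_replacement_product ?GA ?GB "card S\<^sub>B" ?\<tau>
  proof
    show "?\<tau> b (?\<tau> b a) = a" if "a \<in> verts ?GA" "b \<in> verts ?GB" for a b
      using that invol SA by (simp add: verts A.m_assoc)
    show "inj_on (\<lambda>b. ?\<tau> b a) (verts ?GB)" if "a \<in> verts ?GA" for a
      using that act_inj SA by (auto simp: verts inj_on_def)
    show "edges ?GA = {{a, ?\<tau> b a} | a b. a \<in> verts ?GA \<and> b \<in> verts ?GB}"
    proof (intro subset_antisym subsetI)
      fix e assume e: "e \<in> edges ?GA"
      then obtain u v where uv: "e = {u, v}" by (elim GA.edge_cases)
      then obtain s where s: "u \<in> carrier A" "s \<in> S\<^sub>A" "v = u \<otimes>\<^bsub>A\<^esub> s" using e edge_A by auto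
      then obtain b where "b \<in> carrier B" "s = \<phi> b x" using orbit by auto
      then show "e \<in> {{a, ?\<tau> b a} | a b. a \<in> verts ?GA \<and> b \<in> verts ?GB}"
        using uv s unfolding verts by blast
    next
      fix e assume "e \<in> {{a, ?\<tau> b a} | a b. a \<in> verts ?GA \<and> b \<in> verts ?GB}"
      then obtain a b where "e = {a, ?\<tau> b a}" "a \<in> carrier A" "b \<in> carrier B"
        by (auto simp: verts)
      then show "e \<in> edges ?GA" using edge_A[of a "?\<tau> b a"] SA by auto
    qed
    show "verts ?GA \<noteq> {}" by (rule GA.verts_nonempty)
    show "vertex_connectivity ?GA = card (verts ?GB)"
      using \<open>kappa_optimal ?GA\<close> \<open>card S\<^sub>A = order B\<close>
      by (simp add: kappa_optimal_def GA.min_degree_regular verts order_def)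
    show "lambda'_optimal ?GB" by fact
  qed
  have "?G = RP.repl"
  proof (rule graph_eqI)
    fix u v :: "'a \<times> 'b"
    obtain a b a' b' where uv: "u = (a, b)" "v = (a', b')" by (cases u, cases v)
    have "{u, v} \<in> edges ?G \<longleftrightarrow>
        a \<in> carrier A \<and> b \<in> carrier B \<and> (\<exists>s\<in>S. (a', b') = (a, b) \<otimes>\<^bsub>semidirect A B \<phi>\<^esub> s)"
      using cayley_edge_iff[OF SD.group_axioms S_carrier assms(17)[symmetric]]
      by (simp add: uv SD_carrier)
    also have "\<dots> \<longleftrightarrow> a \<in> carrier A \<and> b \<in> carrier B \<and>
        (a' = a \<and> (\<exists>s\<in>S\<^sub>B. b' = b \<otimes>\<^bsub>B\<^esub> s) \<or> b' = b \<and> a' = ?\<tau> b a)"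
      unfolding assms(16) by (auto simp: SD_mult act_one)
    also have "\<dots> \<longleftrightarrow> {u, v} \<in> edges RP.repl"
      by (auto simp: uv RP.repl_edge_iff verts edge_B)
    finally show "{u, v} \<in> edges ?G \<longleftrightarrow> {u, v} \<in> edges RP.repl" .
  qed (simp_all add: RP.verts_repl verts G.finite_simple_graph_axioms
      RP.repl.finite_simple_graph_axioms)
  then show ?thesis
    using RP.lambda'_optimal_repl_iff \<open>card S\<^sub>A = order B\<close> by (simp add: verts order_def)
qed

end
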